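(* Let $m,n\ge 1$ and let $$a(\lambda)=a_0\lambda^m+a_1\lambda^{m-1}+\dots+a_m=a_0(\lambda-\alpha_1)\cdots(\lambda-\alpha_m),$$ $$b(\lambda)=b_0\lambda^n+b_1\lambda^{n-1}+\dots+b_n=b_0(\lambda-\beta_1)\cdots(\lambda-\beta_n)$$ be complex polynomials with $a_0b_0\neq 0$, and let $S=S(a,b)$ be their $(m+n)\times(m+n)$ Sylvester matrix. Suppose that $\alpha_1,\dots,\alpha_m$ are pairwise different and that $\beta_1,\dots,\beta_n$ are pairwise different. Then the adjoint (adjugate) matrix of $S$ is $$\operatorname{adj} S(a,b)=a_0^n\sum_{i=1}^m \Lambda(\alpha_i)\,\frac{\prod_{1\le r\le m,\ r\ne i} b(\alpha_r)}{\left.\frac{a(\lambda)}{\lambda-\alpha_i}\right|_{\lambda=\alpha_i}}\,\Big[\underbrace{0,\dots,0}_{n},\ \mathrm{row}_m\Big(\frac{a(\lambda)}{\lambda-\alpha_i}\Big)\Big]$$ $$\qquad+(-1)^{mn}b_0^m\sum_{j=1}^n \Lambda(\beta_j)\,\frac{\prod_{1\le s\le n,\ s\ne j} a(\beta_s)}{\left.\frac{b(\lambda)}{\lambda-\beta_j}\right|_{\lambda=\beta_j}}\,\Big[\mathrm{row}_n\Big(\frac{b(\lambda)}{\lambda-\beta_j}\Big),\ \underbrace{0,\dots,0}_{m}\Big].$$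
   Context: Sylvester matrix: $S(a,b)$ is the $(m+n)\times(m+n)$ matrix whose first $n$ rows are the successive right shifts of $[a_0,a_1,\dots,a_m,0,\dots,0]$ (row $p$, $1\le p\le n$, has $p-1$ zeros, then $a_0,\dots,a_m$, then $n-p$ zeros), and whose last $m$ rows are the successive right shifts of $[b_0,b_1,\dots,b_n,0,\dots,0]$ (row $n+p$, $1\le p\le m$, has $p-1$ zeros, then $b_0,\dots,b_n$, then $m-p$ zeros). $\Lambda(\lambda)$ denotes the column of height $m+n$ with entries $\lambda^{m+n-1},\lambda^{m+n-2},\dots,\lambda,1$ from top to bottom. For a polynomial $p(\lambda)=p_0\lambda^{k-1}+p_1\lambda^{k-2}+\dots+p_{k-1}$, $\mathrm{row}_k(p(\lambda))$ denotes the row $[p_0,p_1,\dots,p_{k-1}]$. When $\alpha$ is a zero of $a$, $\frac{a(\lambda)}{\lambda-\alpha}$ denotes the polynomial quotient and $\left.\frac{a(\lambda)}{\lambda-\alpha}\right|_{\lambda=\alpha}$ its value at $\alpha$; similarly for $b$. Empty products equal $1$. *)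

theory Defs
  imports
    Complex_Main
    "Subresultants.Resultant_Prelim"
begin

text \<open>
  The Sylvester matrix is the library's \<^const>\<open>sylvester_mat\<close>: for \<open>a\<close> of degree \<open>m\<close> and \<open>b\<close> of
  degree \<open>n\<close>, its first \<open>n\<close> rows are the right shifts of the coefficients of \<open>a\<close> in descending
  order, and its last \<open>m\<close> rows are those of \<open>b\<close>. The adjugate is the library's \<^const>\<open>adj_mat\<close>,
  the transpose of the cofactor matrix.
\<close>

definition Lambda_col :: "nat \<Rightarrow> 'a :: semiring_1 \<Rightarrow> 'a mat" where
  "Lambda_col N x = mat N 1 (\<lambda>(i, _). x ^ (N - 1 - i))"

text \<open>Meant for polynomials of degree less than \<open>k\<close>; coefficients in descending order.\<close>

definition row_poly :: "nat \<Rightarrow> 'a :: zero poly \<Rightarrow> 'a vec" where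
  "row_poly k p = vec k (\<lambda>j. coeff p (k - 1 - j))"

text \<open>
  The type of matrices is not in \<^class>\<open>comm_monoid_add\<close>, so \<^const>\<open>sum\<close> does not apply to
  matrices; their finite sums are taken in the additive monoid of \<open>r\<close> by \<open>c\<close> matrices.
\<close>

abbreviation sum_of_mats :: "nat \<Rightarrow> nat \<Rightarrow> ('i \<Rightarrow> 'a :: ring_1 mat) \<Rightarrow> 'i set \<Rightarrow> 'a mat" where
  "sum_of_mats r c f I \<equiv> finsum (module_mat TYPE('a) r c) f I"

end

theory Submission
  imports Defs
begin

text \<open>
  Write \<open>S\<close> for the Sylvester matrix, \<open>R\<close> for the claimed adjugate, and
  \<open>q\<^sub>i = a / (\<lambda> - \<alpha>\<^sub>i)\<close>. Row \<open>p\<close> of \<open>S\<close> times \<open>\<Lambda>(x)\<close> is \<open>x\<^sup>k a(x)\<close> or \<open>x\<^sup>k b(x)\<close>, and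
  Lagrange interpolation of \<open>x\<^sup>p\<close> at the \<open>\<alpha>\<^sub>i\<close> gives
  \<open>\<Sum>\<^sub>i \<alpha>\<^sub>i\<^sup>p q\<^sub>i / q\<^sub>i(\<alpha>\<^sub>i) = \<lambda>\<^sup>p\<close>; together with the same facts for \<open>b\<close> this makes \<open>S R\<close> the scalar
  matrix \<open>a\<^sub>0\<^sup>n \<Prod>\<^sub>i b(\<alpha>\<^sub>i)\<close>. That scalar is \<open>det S\<close>: multiplying \<open>S\<close> by the block matrix with columns
  \<open>e\<^sub>1, \<dots>, e\<^sub>n, \<Lambda>(\<alpha>\<^sub>1), \<dots>, \<Lambda>(\<alpha>\<^sub>m)\<close> makes it block triangular. If \<open>det S \<noteq> 0\<close>, cancelling \<open>S\<close> in
  \<open>S R = S adj S\<close> finishes the proof. If \<open>a\<close> and \<open>b\<close> have a common root, replace every \<open>\<beta>\<^sub>j\<close> by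
  \<open>\<beta>\<^sub>j + t\<close>: for small \<open>t \<noteq> 0\<close> there is no common root, and both sides are continuous in \<open>t\<close>.
\<close>

section \<open>Entries of finite sums of matrices\<close>

lemma index_sum_of_mats:
  fixes f :: "'i \<Rightarrow> 'b :: comm_ring_1 mat"
  assumes "finite I" and "\<And>k. k \<in> I \<Longrightarrow> f k \<in> carrier_mat r c"
  shows "sum_of_mats r c f I \<in> carrier_mat r c"
    and "i < r \<Longrightarrow> j < c \<Longrightarrow> sum_of_mats r c f I $$ (i, j) = (\<Sum>k\<in>I. f k $$ (i, j))"
proof -
  interpret M: abelian_group "module_mat TYPE('b) r c"
    by (rule abelian_group_mat)
  have closed: "sum_of_mats r c f J \<in> carrier_mat r c" if "\<And>k. k \<in> J \<Longrightarrow> f k \<in> carrier_mat r c" for J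
    using M.finsum_closed[of f J] that by (auto simp: module_mat_simps)
  then show "sum_of_mats r c f I \<in> carrier_mat r c" using assms(2) .
  show "i < r \<Longrightarrow> j < c \<Longrightarrow> sum_of_mats r c f I $$ (i, j) = (\<Sum>k\<in>I. f k $$ (i, j))"
    using assms
  proof (induction rule: finite_induct)
    case empty
    then show ?case using M.finsum_empty[of f] by (simp add: module_mat_simps)
  next
    case (insert x F)
    have "sum_of_mats r c f (insert x F) = f x + sum_of_mats r c f F"
      using insert by (subst M.finsum_insert) (auto simp: module_mat_simps)
    then show ?case
      using insert closed[of F] by auto
  qed
qed

section \<open>Polynomials given by their roots; Lagrange interpolation\<close>

text \<open>The index set is arbitrary so that division by the linear factor at \<open>i\<close>
  stays within the same form, with \<open>I - {i}\<close> in place of \<open>I\<close>.\<close>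

definition root_poly :: "'a :: comm_ring_1 \<Rightarrow> 'i set \<Rightarrow> ('i \<Rightarrow> 'a) \<Rightarrow> 'a poly" where
  "root_poly c I \<gamma> = smult c (\<Prod>i\<in>I. [:- \<gamma> i, 1:])"

lemma poly_root_poly: "poly (root_poly c I \<gamma>) x = c * (\<Prod>i\<in>I. x - \<gamma> i)"
  by (simp add: root_poly_def poly_prod)

lemma poly_root_poly_root:
  assumes "finite I" "i \<in> I"
  shows "poly (root_poly c I \<gamma>) (\<gamma> i) = 0"
proof -
  have "(\<Prod>j\<in>I. \<gamma> i - \<gamma> j) = 0" using assms by (intro prod_zero) auto
  then show ?thesis by (simp add: poly_root_poly)
qed

lemma degree_root_poly:
  fixes c :: "'a :: idom"
  assumes "c \<noteq> 0"
  shows "degree (root_poly c I \<gamma>) = card I"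
  using assms by (simp add: root_poly_def degree_prod_sum_eq)

lemma coeff_root_poly_card:
  fixes c :: "'a :: idom"
  shows "coeff (root_poly c I \<gamma>) (card I) = c"
proof -
  have "degree (\<Prod>i\<in>I. [:- \<gamma> i, 1:]) = card I"
    by (simp add: degree_prod_sum_eq)
  then have "coeff (\<Prod>i\<in>I. [:- \<gamma> i, 1:]) (card I) = lead_coeff (\<Prod>i\<in>I. [:- \<gamma> i, 1:])"
    by simp
  also have "\<dots> = 1" by (subst lead_coeff_prod) simp
  finally show ?thesis by (simp add: root_poly_def)
qed

lemma root_poly_div:
  fixes c :: "'a :: field"
  assumes "finite I" "i \<in> I"
  shows "root_poly c I \<gamma> div [:- \<gamma> i, 1:] = root_poly c (I - {i}) \<gamma>"
proof -
  have "root_poly c I \<gamma> = [:- \<gamma> i, 1:] * root_poly c (I - {i}) \<gamma>"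
    unfolding root_poly_def by (simp add: prod.remove[OF assms] del: mult_pCons_left)
  then show ?thesis by (simp del: mult_pCons_left)
qed

lemma root_poly_deleted_nonzero:
  fixes c :: "'a :: idom"
  assumes "finite I" "inj_on \<gamma> I" "c \<noteq> 0" "i \<in> I"
  shows "poly (root_poly c (I - {i}) \<gamma>) (\<gamma> i) \<noteq> 0"
  using assms by (auto simp: poly_root_poly dest: inj_onD)

text \<open>Both sides have degree below \<open>card I\<close> and agree at the
  \<open>card I\<close> distinct nodes. The factor \<open>c\<close> cancels between numerator and
  denominator.\<close>

lemma lagrange_interpolation_root_poly:
  fixes c :: "'a :: field"
  assumes I: "finite I" "inj_on \<gamma> I" "c \<noteq> 0" and deg: "degree f < card I"
  shows "(\<Sum>i\<in>I. smult (poly f (\<gamma> i) / poly (root_poly c (I - {i}) \<gamma>) (\<gamma> i))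
    (root_poly c (I - {i}) \<gamma>)) = f" (is "?L = f")
proof (rule poly_eqI_degree[of "\<gamma> ` I"])
  have card: "card (\<gamma> ` I) = card I" using I by (simp add: card_image)
  show "degree f < card (\<gamma> ` I)" using deg card by simp
  have "degree ?L \<le> card I - 1"
  proof (rule degree_sum_le[OF I(1)])
    fix i assume "i \<in> I"
    then have "degree (root_poly c (I - {i}) \<gamma>) = card I - 1"
      using I by (simp add: degree_root_poly)
    then show "degree (smult (poly f (\<gamma> i) / poly (root_poly c (I - {i}) \<gamma>) (\<gamma> i))
        (root_poly c (I - {i}) \<gamma>)) \<le> card I - 1"
      by (metis degree_smult_le)
  qed
  then show "degree ?L < card (\<gamma> ` I)" using deg card by linarith
  fix x assume "x \<in> \<gamma> ` I"
  then obtain k where k: "k \<in> I" "x = \<gamma> k" by auto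
  have "poly ?L x = (\<Sum>i\<in>I. if i = k then poly f x else 0)"
    unfolding poly_sum poly_smult
  proof (rule sum.cong[OF refl])
    fix i assume i: "i \<in> I"
    show "poly f (\<gamma> i) / poly (root_poly c (I - {i}) \<gamma>) (\<gamma> i) * poly (root_poly c (I - {i}) \<gamma>) x
      = (if i = k then poly f x else 0)"
      using root_poly_deleted_nonzero[OF I i] poly_root_poly_root[of "I - {i}" k c \<gamma>] I k
      by auto
  qed
  also have "\<dots> = poly f x" using I k by simp
  finally show "poly ?L x = poly f x" .
qed

text \<open>This is coefficient \<open>l\<close> of the interpolant of \<open>monom 1 p\<close>. It
  says that the coefficients of the Lagrange basis form the inverse of the Vandermonde
  matrix.\<close>

lemma sum_power_coeff_root_poly:
  fixes c :: "'a :: field"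
  assumes "finite I" "inj_on \<gamma> I" "c \<noteq> 0" "p < card I"
  shows "(\<Sum>i\<in>I. \<gamma> i ^ p / poly (root_poly c (I - {i}) \<gamma>) (\<gamma> i)
    * coeff (root_poly c (I - {i}) \<gamma>) l) = (if p = l then 1 else 0)"
proof -
  have "(\<Sum>i\<in>I. smult (\<gamma> i ^ p / poly (root_poly c (I - {i}) \<gamma>) (\<gamma> i))
    (root_poly c (I - {i}) \<gamma>)) = monom 1 p"
    using lagrange_interpolation_root_poly[OF assms(1-3), of "monom 1 p"] assms(4)
    by (simp add: degree_monom_eq poly_monom)
  from arg_cong[OF this, of "\<lambda>q. coeff q l"] show ?thesis
    by (simp add: coeff_sum)
qed

section \<open>The Sylvester matrix times the claimed adjugate\<close>

text \<open>Row \<open>i\<close> lists, in descending order, the coefficients of a monomial times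
  \<open>a\<close> or \<open>b\<close>, so pairing it with powers of \<open>x\<close> evaluates that
  product. For \<open>i \<ge> n\<close> the exponent \<open>m + n - 1 - i\<close> is
  \<open>m - 1 - (i - n)\<close>, the shift within the lower block.\<close>

lemma sylvester_mat_row_eval:
  fixes a b :: "'a :: comm_ring_1 poly"
  assumes a: "degree a = m" and b: "degree b = n" and i: "i < m + n"
  shows "(\<Sum>l<m + n. sylvester_mat a b $$ (i, l) * x ^ (m + n - 1 - l)) =
    (if i < n then x ^ (n - 1 - i) * poly a x else x ^ (m + n - 1 - i) * poly b x)"
proof -
  define p where "p = (if i < n then monom 1 (n - 1 - i) * a else monom 1 (m + n - 1 - i) * b)"
  have deg: "degree p < m + n"
  proof -
    have "degree (monom (1 :: 'a) k * q) \<le> k + degree q" for k q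
      by (intro order.trans[OF degree_mult_le] add_mono degree_monom_le order.refl)
    from this[of "n - 1 - i" a] this[of "m + n - 1 - i" b]
    have "degree p \<le> (if i < n then n - 1 - i + m else m + n - 1 - i + n)"
      unfolding p_def using a b by auto
    then show ?thesis using i by (auto split: if_splits)
  qed
  have "(\<Sum>l<m + n. sylvester_mat a b $$ (i, l) * x ^ (m + n - 1 - l))
      = (\<Sum>l<m + n. coeff p (m + n - Suc l) * x ^ (m + n - Suc l))"
  proof (rule sum.cong[OF refl])
    fix l assume "l \<in> {..<m + n}"
    then have l: "l < m + n" by simp
    have "sylvester_mat a b $$ (i, l) = coeff p (m + n - Suc l)"
      using i l a b unfolding p_def
      by (subst sylvester_index_mat2) (auto simp: coeff_monom_mult)
    then show "sylvester_mat a b $$ (i, l) * x ^ (m + n - 1 - l)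
      = coeff p (m + n - Suc l) * x ^ (m + n - Suc l)" by simp
  qed
  also have "\<dots> = (\<Sum>l<m + n. coeff p l * x ^ l)"
    by (rule sum.nat_diff_reindex)
  also have "\<dots> = poly p x"
    unfolding poly_altdef using deg
    by (intro sum.mono_neutral_right) (auto simp: coeff_eq_0)
  finally show ?thesis by (auto simp: p_def poly_monom)
qed

text \<open>
  Entry \<open>(i, j)\<close> of either sum in the adjugate formula: the row vector occupies the columns
  \<open>off, \<dots>, off + k - 1\<close>, where \<open>k\<close> is meant to be \<open>card I\<close>.
\<close>

definition adj_half :: "nat \<Rightarrow> nat \<Rightarrow> nat \<Rightarrow> 'a :: field poly \<Rightarrow> 'a \<Rightarrow> 'i set \<Rightarrow> ('i \<Rightarrow> 'a) \<Rightarrow> nat \<Rightarrow> nat \<Rightarrow> 'a"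
  where
  "adj_half N off k f c I \<gamma> i j = (\<Sum>r\<in>I.
    (\<Prod>s\<in>I - {r}. poly f (\<gamma> s)) / poly (root_poly c (I - {r}) \<gamma>) (\<gamma> r) * \<gamma> r ^ (N - 1 - i) *
    (if off \<le> j \<and> j < off + k then coeff (root_poly c (I - {r}) \<gamma>) (k - 1 - (j - off)) else 0))"

text \<open>After exchanging the sums, a row \<open>w\<close> enters only through its pairings with
  the columns \<Lambda>(\<gamma> r), which are known for the rows of a Sylvester matrix.\<close>

lemma sum_mult_adj_half:
  "(\<Sum>l<N. w l * adj_half N off k f c I \<gamma> l j) =
    (\<Sum>r\<in>I. (\<Prod>s\<in>I - {r}. poly f (\<gamma> s)) / poly (root_poly c (I - {r}) \<gamma>) (\<gamma> r) *
      (if off \<le> j \<and> j < off + k then coeff (root_poly c (I - {r}) \<gamma>) (k - 1 - (j - off)) else 0) *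
      (\<Sum>l<N. w l * \<gamma> r ^ (N - 1 - l)))"
  unfolding adj_half_def sum_distrib_left
  by (subst sum.swap) (intro sum.cong refl, simp only: mult_ac)

text \<open>The factor \<open>poly f (\<gamma> r)\<close> coming from \<open>w\<close> completes the
  product over \<open>I - {r}\<close> to the one over \<open>I\<close>, which no longer depends on
  \<open>r\<close>. What remains under the sum is \<open>sum_power_coeff_root_poly\<close>.\<close>

lemma sum_power_adj_half:
  fixes c :: "'a :: field"
  assumes I: "finite I" "inj_on \<gamma> I" "c \<noteq> 0" and k: "card I = k"
    and w: "\<And>r. r \<in> I \<Longrightarrow> (\<Sum>l<N. w l * \<gamma> r ^ (N - 1 - l)) = \<gamma> r ^ p * poly f (\<gamma> r)"
    and p: "p < k"
  shows "(\<Sum>l<N. w l * adj_half N off k f c I \<gamma> l j) =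
    (if off \<le> j \<and> j < off + k \<and> p = k - 1 - (j - off) then \<Prod>r\<in>I. poly f (\<gamma> r) else 0)"
proof -
  let ?q = "\<lambda>r. root_poly c (I - {r}) \<gamma>"
  define u where "u r = (if off \<le> j \<and> j < off + k then coeff (?q r) (k - 1 - (j - off)) else 0)" for r
  have "(\<Sum>l<N. w l * adj_half N off k f c I \<gamma> l j) =
    (\<Sum>r\<in>I. (\<Prod>s\<in>I. poly f (\<gamma> s)) * (\<gamma> r ^ p / poly (?q r) (\<gamma> r) * u r))"
    unfolding sum_mult_adj_half u_def[symmetric]
  proof (rule sum.cong[OF refl])
    fix r assume r: "r \<in> I"
    show "(\<Prod>s\<in>I - {r}. poly f (\<gamma> s)) / poly (?q r) (\<gamma> r) * u r * (\<Sum>l<N. w l * \<gamma> r ^ (N - 1 - l))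
      = (\<Prod>s\<in>I. poly f (\<gamma> s)) * (\<gamma> r ^ p / poly (?q r) (\<gamma> r) * u r)"
      unfolding w[OF r] prod.remove[OF I(1) r] by simp
  qed
  also have "\<dots> = (\<Prod>s\<in>I. poly f (\<gamma> s)) * (\<Sum>r\<in>I. \<gamma> r ^ p / poly (?q r) (\<gamma> r) * u r)"
    by (rule sum_distrib_left[symmetric])
  also have "(\<Sum>r\<in>I. \<gamma> r ^ p / poly (?q r) (\<gamma> r) * u r) =
    (if off \<le> j \<and> j < off + k \<and> p = k - 1 - (j - off) then 1 else 0)"
  proof (cases "off \<le> j \<and> j < off + k")
    case True
    then show ?thesis
      using sum_power_coeff_root_poly[OF I p[folded k], of "k - 1 - (j - off)"] by (simp add: u_def)
  next
    case False
    then have "u = (\<lambda>r. 0)" by (auto simp: u_def)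
    with False show ?thesis by auto
  qed
  finally show ?thesis by simp
qed

text \<open>Serves the rows built from the polynomial whose roots are the \<gamma> r: they
  annihilate every \<Lambda>(\<gamma> r).\<close>

lemma sum_root_adj_half:
  assumes "\<And>r. r \<in> I \<Longrightarrow> (\<Sum>l<N. w l * \<gamma> r ^ (N - 1 - l)) = 0"
  shows "(\<Sum>l<N. w l * adj_half N off k f c I \<gamma> l j) = 0"
  unfolding sum_mult_adj_half using assms by simp

text \<open>The claimed adjugate, kept entrywise until the final theorem; the quotients by linear
  factors appear as \<open>root_poly\<close> with one index deleted.\<close>

definition lagrange_adj :: "nat \<Rightarrow> nat \<Rightarrow> 'a :: field \<Rightarrow> (nat \<Rightarrow> 'a) \<Rightarrow> 'a \<Rightarrow> (nat \<Rightarrow> 'a) \<Rightarrow> 'a mat" where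
  "lagrange_adj m n c \<alpha> d \<beta> = mat (m + n) (m + n) (\<lambda>(i, j).
    c ^ n * adj_half (m + n) n m (root_poly d {1..n} \<beta>) c {1..m} \<alpha> i j +
    (-1) ^ (m * n) * d ^ m * adj_half (m + n) 0 n (root_poly c {1..m} \<alpha>) d {1..n} \<beta> i j)"

text \<open>Two forms of the resultant: both sides are \<open>c ^ n * d ^ m\<close> times the
  product of all differences \<alpha> i - \<beta> j, and the sign comes from reversing
  \<open>m * n\<close> differences.\<close>

lemma prod_poly_root_poly_swap:
  fixes c :: "'a :: comm_ring_1"
  shows "d ^ m * (\<Prod>j=1..n. poly (root_poly c {1..m} \<alpha>) (\<beta> j)) * (-1) ^ (m * n)
    = c ^ n * (\<Prod>i=1..m. poly (root_poly d {1..n} \<beta>) (\<alpha> i))"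
proof -
  have "(\<Prod>j=1..n. \<Prod>i=1..m. \<beta> j - \<alpha> i) = (\<Prod>j=1..n. \<Prod>i=1..m. (-1) * (\<alpha> i - \<beta> j))"
    by simp
  also have "\<dots> = (-1) ^ (m * n) * (\<Prod>j=1..n. \<Prod>i=1..m. \<alpha> i - \<beta> j)"
    by (simp only: prod.distrib) (simp add: power_mult)
  finally have "(\<Prod>j=1..n. \<Prod>i=1..m. \<beta> j - \<alpha> i) * (-1) ^ (m * n)
      = (\<Prod>i=1..m. \<Prod>j=1..n. \<alpha> i - \<beta> j)"
    by (subst (2) prod.swap) (simp add: mult_ac flip: power_add power_mult_distrib)
  then show ?thesis
    by (simp add: poly_root_poly prod.distrib mult_ac)
qed

text \<open>Each row of the Sylvester matrix annihilates one half of the formula, and interpolation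
  turns the other half into a multiple of a unit row. Common roots are allowed here; the scalar is
  then 0.\<close>

lemma sylvester_mat_mult_lagrange_adj:
  fixes c d :: "'a :: field" and m n :: nat and \<alpha> \<beta> :: "nat \<Rightarrow> 'a"
  defines "a \<equiv> root_poly c {1..m} \<alpha>" and "b \<equiv> root_poly d {1..n} \<beta>"
  assumes cd: "c \<noteq> 0" "d \<noteq> 0" and inj: "inj_on \<alpha> {1..m}" "inj_on \<beta> {1..n}"
  shows "sylvester_mat a b * lagrange_adj m n c \<alpha> d \<beta> =
    (c ^ n * (\<Prod>i=1..m. poly b (\<alpha> i))) \<cdot>\<^sub>m 1\<^sub>m (m + n)"
proof (rule eq_matI)
  have dims: "degree a = m" "degree b = n"
    using cd by (simp_all add: a_def b_def degree_root_poly)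
  let ?D = "c ^ n * (\<Prod>i=1..m. poly b (\<alpha> i))"
  let ?N = "m + n"
  fix i j
  assume "i < dim_row (?D \<cdot>\<^sub>m 1\<^sub>m ?N)" "j < dim_col (?D \<cdot>\<^sub>m 1\<^sub>m ?N)"
  then have ij: "i < ?N" "j < ?N" by auto
  let ?w = "\<lambda>l. sylvester_mat a b $$ (i, l)"
  let ?A = "\<lambda>l. adj_half ?N n m b c {1..m} \<alpha> l j"
  let ?B = "\<lambda>l. adj_half ?N 0 n a d {1..n} \<beta> l j"
  note row = sylvester_mat_row_eval[OF dims ij(1)]
  have a0: "poly a (\<alpha> r) = 0" if "r \<in> {1..m}" for r
    using that unfolding a_def by (intro poly_root_poly_root) auto
  have b0: "poly b (\<beta> r) = 0" if "r \<in> {1..n}" for r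
    using that unfolding b_def by (intro poly_root_poly_root) auto
  have "(sylvester_mat a b * lagrange_adj m n c \<alpha> d \<beta>) $$ (i, j)
    = (\<Sum>l<?N. ?w l * (c ^ n * ?A l + (-1) ^ (m * n) * d ^ m * ?B l))"
  proof -
    have "lagrange_adj m n c \<alpha> d \<beta> $$ (l, j) = c ^ n * ?A l + (-1) ^ (m * n) * d ^ m * ?B l"
      if "l < ?N" for l
      using that ij by (simp add: lagrange_adj_def a_def b_def)
    moreover have "lagrange_adj m n c \<alpha> d \<beta> \<in> carrier_mat ?N ?N"
      by (simp add: lagrange_adj_def)
    moreover have "sylvester_mat a b \<in> carrier_mat ?N ?N" using dims by auto
    ultimately show ?thesis
      using ij by (auto simp: scalar_prod_def atLeast0LessThan intro!: sum.cong)
  qed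
  also have "\<dots> = c ^ n * (\<Sum>l<?N. ?w l * ?A l) + (-1) ^ (m * n) * d ^ m * (\<Sum>l<?N. ?w l * ?B l)"
    by (simp add: sum_distrib_left sum.distrib algebra_simps)
  also have "\<dots> = (if i = j then ?D else 0)"
  proof (cases "i < n")
    case True
    have "(\<Sum>l<?N. ?w l * ?A l) = 0"
      by (rule sum_root_adj_half) (unfold row, use True in \<open>simp add: a0\<close>)
    moreover have "(\<Sum>l<?N. ?w l * ?B l) =
      (if 0 \<le> j \<and> j < 0 + n \<and> n - 1 - i = n - 1 - (j - 0) then \<Prod>r\<in>{1..n}. poly a (\<beta> r) else 0)"
      by (rule sum_power_adj_half) (unfold row, use True cd inj in auto)
    \<comment> \<open>The upper rows produce the scalar through the values of \<open>a\<close> at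
      the \<beta> r; the sign in the formula makes it equal to the scalar of the lower rows.\<close>
    moreover have "(-1) ^ (m * n) * d ^ m * (\<Prod>r\<in>{1..n}. poly a (\<beta> r)) = ?D"
      using prod_poly_root_poly_swap[where c = c and d = d and m = m and n = n and \<alpha> = \<alpha> and \<beta> = \<beta>] by (simp add: a_def b_def mult_ac)
    moreover have "(j < n \<and> n - 1 - i = n - 1 - j) = (i = j)" using True by auto
    ultimately show ?thesis by auto
  next
    case False
    have "(\<Sum>l<?N. ?w l * ?B l) = 0"
      by (rule sum_root_adj_half) (unfold row, use False in \<open>simp add: b0\<close>)
    moreover have "(\<Sum>l<?N. ?w l * ?A l) =
      (if n \<le> j \<and> j < n + m \<and> ?N - 1 - i = m - 1 - (j - n) then \<Prod>r\<in>{1..m}. poly b (\<alpha> r) else 0)"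
      by (rule sum_power_adj_half) (unfold row, use False ij cd inj in auto)
    moreover have "(n \<le> j \<and> j < n + m \<and> ?N - 1 - i = m - 1 - (j - n)) = (i = j)"
      using False ij by auto
    ultimately show ?thesis by auto
  qed
  finally show "(sylvester_mat a b * lagrange_adj m n c \<alpha> d \<beta>) $$ (i, j) = (?D \<cdot>\<^sub>m 1\<^sub>m ?N) $$ (i, j)"
    using ij by simp
qed (use cd in \<open>simp_all add: lagrange_adj_def a_def b_def degree_root_poly\<close>)

section \<open>The determinant of the Sylvester matrix\<close>

lemma det_sylvester_mat_root_poly:
  fixes c :: "'a :: field" and m :: nat and \<alpha> :: "nat \<Rightarrow> 'a"
  defines "a \<equiv> root_poly c {1..m} \<alpha>"
  assumes c: "c \<noteq> 0" and inj: "inj_on \<alpha> {1..m}" and b: "degree b = n"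
  shows "det (sylvester_mat a b) = c ^ n * (\<Prod>i=1..m. poly b (\<alpha> i))"
proof -
  have a: "degree a = m" using c by (simp add: a_def degree_root_poly)
  let ?N = "m + n" and ?S = "sylvester_mat a b"
  \<comment> \<open>Column \<open>j\<close> of \<open>P\<close> stacked on \<open>V\<close> is
    \<Lambda>(\<alpha> (Suc j)): \<open>P\<close> holds the first \<open>n\<close> entries and the
    Vandermonde matrix \<open>V\<close> the last \<open>m\<close>. \<open>Suc\<close> passes from
    matrix indices, starting at 0, to roots, starting at 1.\<close>
  define V where "V = mat m m (\<lambda>(i, j). \<alpha> (Suc j) ^ (m - 1 - i))"
  \<comment> \<open>Rows of \<open>U\<close> are the Lagrange basis polynomials, so that
    \<open>V * U = 1\<^sub>m m\<close> is \<open>sum_power_coeff_root_poly\<close>.\<close>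
  define U where "U = mat m m (\<lambda>(k, l). coeff (root_poly c ({1..m} - {Suc k}) \<alpha>) (m - 1 - l)
    / poly (root_poly c ({1..m} - {Suc k}) \<alpha>) (\<alpha> (Suc k)))"
  define D where "D = mat m m (\<lambda>(i, j). if i = j then poly b (\<alpha> (Suc i)) else 0)"
  define P where "P = mat n m (\<lambda>(i, j). \<alpha> (Suc j) ^ (?N - 1 - i))"
  define W where "W = four_block_mat (1\<^sub>m n) P (0\<^sub>m m n) V"
  define T where "T = mat n n (\<lambda>(i, j). ?S $$ (i, j))"
  define C where "C = mat m n (\<lambda>(i, j). ?S $$ (n + i, j))"
  have carr: "V \<in> carrier_mat m m" "U \<in> carrier_mat m m" "D \<in> carrier_mat m m" "P \<in> carrier_mat n m"
    "T \<in> carrier_mat n n" "C \<in> carrier_mat m n" "W \<in> carrier_mat ?N ?N" "?S \<in> carrier_mat ?N ?N"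
    using a b by (auto simp: V_def U_def D_def P_def T_def C_def W_def)
  have "V * U = 1\<^sub>m m"
  proof (rule eq_matI)
    fix i j assume "i < dim_row (1\<^sub>m m :: 'a mat)" "j < dim_col (1\<^sub>m m :: 'a mat)"
    then have ij: "i < m" "j < m" by auto
    have "(V * U) $$ (i, j) = (\<Sum>k<m. \<alpha> (Suc k) ^ (m - 1 - i) /
        poly (root_poly c ({1..m} - {Suc k}) \<alpha>) (\<alpha> (Suc k)) *
        coeff (root_poly c ({1..m} - {Suc k}) \<alpha>) (m - 1 - j))"
      using ij by (simp add: V_def U_def scalar_prod_def atLeast0LessThan)
    also have "\<dots> = (\<Sum>k=1..m. \<alpha> k ^ (m - 1 - i) /
        poly (root_poly c ({1..m} - {k}) \<alpha>) (\<alpha> k) *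
        coeff (root_poly c ({1..m} - {k}) \<alpha>) (m - 1 - j))"
      by (rule sum.reindex_bij_witness[of _ "\<lambda>k. k - 1" Suc]) auto
    also have "\<dots> = (if m - 1 - i = m - 1 - j then 1 else 0)"
      using ij inj c by (intro sum_power_coeff_root_poly) auto
    finally show "(V * U) $$ (i, j) = 1\<^sub>m m $$ (i, j)" using ij by auto
  qed (use carr in auto)
  then have "det V * det U = 1" using det_mult[OF carr(1,2)] by simp
  \<comment> \<open>Only invertibility of \<open>V\<close> matters: its determinant occurs on both
    sides below and cancels.\<close>
  then have V0: "det V \<noteq> 0" by auto
  \<comment> \<open>The first \<open>n\<close> columns of \<open>W\<close> are unit vectors and copy
    columns of the Sylvester matrix. On a column \<Lambda>(\<alpha> k) the upper rows give 0, as
    \<alpha> k is a root of \<open>a\<close>, and the lower rows give powers of \<alpha> k times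
    \<open>poly b (\<alpha> k)\<close>, which is a column of \<open>V * D\<close>.\<close>
  have "?S * W = four_block_mat T (0\<^sub>m n m) C (V * D)"
  proof (rule eq_matI)
    fix i j
    assume "i < dim_row (four_block_mat T (0\<^sub>m n m) C (V * D))"
      "j < dim_col (four_block_mat T (0\<^sub>m n m) C (V * D))"
    then have ij: "i < ?N" "j < ?N" using carr by auto
    have Wl: "W $$ (l, j) = (if j < n then (if l = j then 1 else 0) else \<alpha> (Suc (j - n)) ^ (?N - 1 - l))"
      if "l < ?N" for l
      using that ij by (auto simp: W_def P_def V_def)
    have "(?S * W) $$ (i, j) = (\<Sum>l<?N. ?S $$ (i, l) * W $$ (l, j))"
      using ij carr(7,8) by (auto simp: scalar_prod_def atLeast0LessThan intro!: sum.cong)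
    also have "\<dots> = (\<Sum>l<?N. ?S $$ (i, l) *
        (if j < n then (if l = j then 1 else 0) else \<alpha> (Suc (j - n)) ^ (?N - 1 - l)))"
      by (intro sum.cong) (auto simp: Wl)
    also have "\<dots> = four_block_mat T (0\<^sub>m n m) C (V * D) $$ (i, j)"
    proof (cases "j < n")
      case True
      then have "(\<Sum>l<?N. ?S $$ (i, l) *
          (if j < n then (if l = j then 1 else 0) else \<alpha> (Suc (j - n)) ^ (?N - 1 - l)))
        = (\<Sum>l<?N. if l = j then ?S $$ (i, l) else 0)"
        by (intro sum.cong) auto
      also have "\<dots> = four_block_mat T (0\<^sub>m n m) C (V * D) $$ (i, j)"
        using True ij carr by (auto simp: T_def C_def)
      finally show ?thesis .
    next
      case False
      have root: "poly a (\<alpha> (Suc (j - n))) = 0"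
        unfolding a_def using False ij by (intro poly_root_poly_root) auto
      have VD: "(V * D) $$ (i', j') = \<alpha> (Suc j') ^ (m - 1 - i') * poly b (\<alpha> (Suc j'))"
        if "i' < m" "j' < m" for i' j'
        using that by (simp add: V_def D_def scalar_prod_def if_distrib cong: if_cong)
      show ?thesis
        using False ij carr sylvester_mat_row_eval[OF a b ij(1), of "\<alpha> (Suc (j - n))"]
        by (auto simp: root VD simp del: index_mult_mat(1))
    qed
    finally show "(?S * W) $$ (i, j) = four_block_mat T (0\<^sub>m n m) C (V * D) $$ (i, j)" .
  qed (use carr in auto)
  then have "det ?S * det W = det T * det (V * D)"
    using det_mult[OF carr(8,7)] det_four_block_mat_upper_right_zero[OF carr(5) refl carr(6), of "V * D"] carr
    by auto
  moreover have "det W = det V"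
    unfolding W_def by (subst det_four_block_mat_lower_left_zero) (use carr in auto)
  moreover have "det (V * D) = det V * (\<Prod>i=1..m. poly b (\<alpha> i))"
  proof -
    have "det D = (\<Prod>i = 0..<m. D $$ (i, i))"
      using carr by (subst det_upper_triangular) (auto simp: prod_list_diag_prod D_def)
    also have "\<dots> = (\<Prod>i=1..m. poly b (\<alpha> i))"
      by (rule prod.reindex_bij_witness[of _ "\<lambda>k. k - 1" Suc]) (auto simp: D_def)
    finally show ?thesis by (simp add: det_mult[OF carr(1,3)])
  qed
  moreover have "det T = c ^ n"
  proof -
    \<comment> \<open>\<open>T\<close> consists of the right shifts of the coefficients of
      \<open>a\<close>, cut off after \<open>n\<close> columns; its diagonal is the leading
      coefficient.\<close>
    have "upper_triangular T"
      using a b by (auto simp: T_def sylvester_index_mat)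
    then have "det T = (\<Prod>i = 0..<n. T $$ (i, i))"
      using carr by (subst det_upper_triangular) (auto simp: prod_list_diag_prod)
    also have "\<dots> = (\<Prod>i = 0..<n. c)"
      using a b coeff_root_poly_card[of c "{1..m}" \<alpha>]
      by (intro prod.cong[OF refl]) (auto simp: T_def sylvester_index_mat a_def)
    finally show ?thesis by simp
  qed
  ultimately show ?thesis using V0 by (simp add: mult_ac)
qed

section \<open>The adjugate when there is no common root\<close>

lemma adj_mat_sylvester_mat_coprime:
  fixes c d :: "'a :: field" and m n :: nat and \<alpha> \<beta> :: "nat \<Rightarrow> 'a"
  defines "a \<equiv> root_poly c {1..m} \<alpha>" and "b \<equiv> root_poly d {1..n} \<beta>"
  assumes cd: "c \<noteq> 0" "d \<noteq> 0" and inj: "inj_on \<alpha> {1..m}" "inj_on \<beta> {1..n}"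
    and nz: "\<And>i. i \<in> {1..m} \<Longrightarrow> poly b (\<alpha> i) \<noteq> 0"
  shows "adj_mat (sylvester_mat a b) = lagrange_adj m n c \<alpha> d \<beta>"
proof -
  have deg: "degree a = m" "degree b = n"
    using cd by (simp_all add: a_def b_def degree_root_poly)
  let ?S = "sylvester_mat a b" and ?R = "lagrange_adj m n c \<alpha> d \<beta>" and ?N = "m + n"
  have S: "?S \<in> carrier_mat ?N ?N" using deg by auto
  have R: "?R \<in> carrier_mat ?N ?N" by (simp add: lagrange_adj_def)
  note adj = adj_mat[OF S]
  have det: "det ?S = c ^ n * (\<Prod>i=1..m. poly b (\<alpha> i))"
    unfolding a_def by (rule det_sylvester_mat_root_poly[OF cd(1) inj(1) deg(2)])
  then have D0: "det ?S \<noteq> 0" using cd nz by auto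
  have "?S * ?R = det ?S \<cdot>\<^sub>m 1\<^sub>m ?N"
    unfolding det unfolding a_def b_def by (rule sylvester_mat_mult_lagrange_adj[OF cd inj])
  \<comment> \<open>Evaluating this triple product with either bracketing gives
    \<open>det ?S\<close> times the adjugate and \<open>det ?S\<close> times \<open>?R\<close>; no
    inverse matrix has to be introduced.\<close>
  then have "adj_mat ?S * (?S * ?R) = det ?S \<cdot>\<^sub>m adj_mat ?S"
    using adj(1) mult_smult_distrib[OF adj(1) one_carrier_mat[of ?N]] by simp
  moreover have "adj_mat ?S * (?S * ?R) = det ?S \<cdot>\<^sub>m ?R"
    using assoc_mult_mat[OF adj(1) S R] adj(3) R
      mult_smult_assoc_mat[OF one_carrier_mat R]
    by simp
  ultimately have eq: "det ?S \<cdot>\<^sub>m adj_mat ?S = det ?S \<cdot>\<^sub>m ?R" by simp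
  show ?thesis
  proof (rule eq_matI)
    fix i j assume "i < dim_row ?R" "j < dim_col ?R"
    then show "adj_mat ?S $$ (i, j) = ?R $$ (i, j)"
      using arg_cong[OF eq, of "\<lambda>M. M $$ (i, j)"] D0 adj(1) R by auto
  qed (use adj(1) R in auto)
qed

section \<open>Continuity in the entries and in the roots\<close>

text \<open>By the Leibniz formula the determinant is a polynomial in the entries.\<close>

lemma tendsto_det:
  fixes A :: "'t \<Rightarrow> 'a :: real_normed_field mat"
  assumes A: "\<And>t. A t \<in> carrier_mat n n" and B: "B \<in> carrier_mat n n"
    and lim: "\<And>i j. i < n \<Longrightarrow> j < n \<Longrightarrow> ((\<lambda>t. A t $$ (i, j)) \<longlongrightarrow> B $$ (i, j)) F"
  shows "((\<lambda>t. det (A t)) \<longlongrightarrow> det B) F"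
  unfolding det_def'[OF A] det_def'[OF B]
proof (intro tendsto_sum tendsto_mult tendsto_prod tendsto_const lim)
  fix p i assume "p \<in> {p. p permutes {0..<n}}" "i \<in> {0..<n}"
  then show "i < n" "p i < n" using permutes_in_image[of p "{0..<n}" i] by auto
qed

lemma tendsto_adj_mat:
  fixes A :: "'t \<Rightarrow> 'a :: real_normed_field mat"
  assumes A: "\<And>t. A t \<in> carrier_mat n n" and B: "B \<in> carrier_mat n n"
    and lim: "\<And>i j. i < n \<Longrightarrow> j < n \<Longrightarrow> ((\<lambda>t. A t $$ (i, j)) \<longlongrightarrow> B $$ (i, j)) F"
    and ij: "i < n" "j < n"
  shows "((\<lambda>t. adj_mat (A t) $$ (i, j)) \<longlongrightarrow> adj_mat B $$ (i, j)) F"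
proof -
  have adj: "adj_mat M $$ (i, j) = (-1) ^ (j + i) * det (mat_delete M j i)"
    if "M \<in> carrier_mat n n" for M :: "'a mat"
    using that ij by (auto simp: adj_mat_def cofactor_def)
  have del: "mat_delete M j i \<in> carrier_mat (n - 1) (n - 1)" if "M \<in> carrier_mat n n" for M :: "'a mat"
    using mat_delete_carrier[OF that] .
  have entry: "mat_delete M j i $$ (i', j') =
      M $$ (if i' < j then i' else Suc i', if j' < i then j' else Suc j')"
    if "M \<in> carrier_mat n n" "i' < n - 1" "j' < n - 1" for M :: "'a mat" and i' j'
    using that by (auto simp: mat_delete_def)
  have "((\<lambda>t. det (mat_delete (A t) j i)) \<longlongrightarrow> det (mat_delete B j i)) F"
  proof (rule tendsto_det[where n = "n - 1"])
    fix i' j' assume "i' < n - 1" "j' < n - 1"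
    then show "((\<lambda>t. mat_delete (A t) j i $$ (i', j')) \<longlongrightarrow> mat_delete B j i $$ (i', j')) F"
      unfolding entry[OF A \<open>i' < n - 1\<close> \<open>j' < n - 1\<close>] entry[OF B \<open>i' < n - 1\<close> \<open>j' < n - 1\<close>]
      by (intro lim) auto
  qed (use del A B in auto)
  then show ?thesis
    unfolding adj[OF A] adj[OF B] by (intro tendsto_mult tendsto_const)
qed

text \<open>Induction over the linear factors. The coefficient index stays arbitrary because the
  convolution in \<open>coeff_mult\<close> involves other coefficients of the smaller
  product.\<close>

lemma tendsto_coeff_root_poly:
  fixes \<gamma> :: "'t \<Rightarrow> 'i \<Rightarrow> 'a :: real_normed_field"
  assumes "finite I" and "\<And>i. i \<in> I \<Longrightarrow> ((\<lambda>t. \<gamma> t i) \<longlongrightarrow> g i) F"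
  shows "((\<lambda>t. coeff (root_poly c I (\<gamma> t)) k) \<longlongrightarrow> coeff (root_poly c I g) k) F"
proof -
  have "((\<lambda>t. coeff (\<Prod>i\<in>I. [:- \<gamma> t i, 1:]) k) \<longlongrightarrow> coeff (\<Prod>i\<in>I. [:- g i, 1:]) k) F"
    using assms
  proof (induction I arbitrary: k rule: finite_induct)
    case empty
    then show ?case by simp
  next
    case (insert x I)
    have "((\<lambda>t. coeff [:- \<gamma> t x, 1:] l) \<longlongrightarrow> coeff [:- g x, 1:] l) F" for l
      using insert.prems by (auto simp: coeff_pCons split: nat.split intro!: tendsto_intros)
    then show ?case
      using insert unfolding prod.insert[OF insert.hyps(1,2)] coeff_mult
      by (intro tendsto_sum tendsto_mult) auto
  qed
  then show ?thesis by (auto simp: root_poly_def intro: tendsto_intros)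
qed

lemma tendsto_poly_root_poly:
  fixes \<gamma> :: "'t \<Rightarrow> 'i \<Rightarrow> 'a :: real_normed_field"
  assumes "\<And>i. i \<in> I \<Longrightarrow> ((\<lambda>t. \<gamma> t i) \<longlongrightarrow> g i) F" and "(x \<longlongrightarrow> y) F"
  shows "((\<lambda>t. poly (root_poly c I (\<gamma> t)) (x t)) \<longlongrightarrow> poly (root_poly c I g) y) F"
  unfolding poly_root_poly using assms by (intro tendsto_intros)

text \<open>The denominators have nonzero limits because the limit nodes are distinct. Both
  \<open>f\<close> and the nodes may vary: the perturbed polynomial is evaluated in one half of the
  formula and supplies the nodes in the other.\<close>

lemma tendsto_adj_half:
  fixes \<gamma> :: "'t \<Rightarrow> 'i \<Rightarrow> 'a :: real_normed_field"
  assumes I: "finite I" "inj_on g I" "c \<noteq> 0"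
    and f: "\<And>r. r \<in> I \<Longrightarrow> ((\<lambda>t. poly (f t) (\<gamma> t r)) \<longlongrightarrow> poly h (g r)) F"
    and \<gamma>: "\<And>r. r \<in> I \<Longrightarrow> ((\<lambda>t. \<gamma> t r) \<longlongrightarrow> g r) F"
  shows "((\<lambda>t. adj_half N off k (f t) c I (\<gamma> t) i j) \<longlongrightarrow> adj_half N off k h c I g i j) F"
  unfolding adj_half_def
proof (intro tendsto_sum tendsto_mult tendsto_divide tendsto_prod tendsto_power)
  fix r assume r: "r \<in> I"
  show "((\<lambda>t. poly (root_poly c (I - {r}) (\<gamma> t)) (\<gamma> t r)) \<longlongrightarrow>
      poly (root_poly c (I - {r}) g) (g r)) F"
    using r \<gamma> by (intro tendsto_poly_root_poly) auto
  show "poly (root_poly c (I - {r}) g) (g r) \<noteq> 0"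
    by (rule root_poly_deleted_nonzero[OF I r])
  have "((\<lambda>t. coeff (root_poly c (I - {r}) (\<gamma> t)) l) \<longlongrightarrow> coeff (root_poly c (I - {r}) g) l) F" for l
    using I \<gamma> by (intro tendsto_coeff_root_poly) auto
  then show "((\<lambda>t. if off \<le> j \<and> j < off + k
        then coeff (root_poly c (I - {r}) (\<gamma> t)) (k - 1 - (j - off)) else 0) \<longlongrightarrow>
      (if off \<le> j \<and> j < off + k then coeff (root_poly c (I - {r}) g) (k - 1 - (j - off)) else 0)) F"
    by auto
qed (use f \<gamma> in auto)

section \<open>Common roots, by perturbation\<close>

lemma adj_mat_sylvester_mat_root_poly:
  fixes c d :: "'a :: real_normed_field" and m n :: nat and \<alpha> \<beta> :: "nat \<Rightarrow> 'a"
  assumes cd: "c \<noteq> 0" "d \<noteq> 0" and inj: "inj_on \<alpha> {1..m}" "inj_on \<beta> {1..n}"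
  shows "adj_mat (sylvester_mat (root_poly c {1..m} \<alpha>) (root_poly d {1..n} \<beta>)) =
    lagrange_adj m n c \<alpha> d \<beta>"
proof -
  define a where "a = root_poly c {1..m} \<alpha>"
  define b where "b = root_poly d {1..n} \<beta>"
  \<comment> \<open>A common shift keeps the roots distinct and leaves the degree and leading
    coefficient unchanged.\<close>
  define \<beta>' where "\<beta>' t j = \<beta> j + t" for t j
  define b' where "b' t = root_poly d {1..n} (\<beta>' t)" for t
  let ?N = "m + n"
  have a: "degree a = m" and b: "degree b = n" and b't: "degree (b' t) = n" for t
    using cd by (simp_all add: a_def b_def b'_def degree_root_poly)
  have S: "sylvester_mat a b \<in> carrier_mat ?N ?N" and S': "sylvester_mat a (b' t) \<in> carrier_mat ?N ?N" for t
    using a b b't[of t] by auto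
  have lim_\<beta>: "((\<lambda>t. \<beta>' t j) \<longlongrightarrow> \<beta> j) (at 0)" for j
  proof -
    have "((\<lambda>t. \<beta> j + t) \<longlongrightarrow> \<beta> j + 0) (at 0)" by (intro tendsto_intros)
    then show ?thesis by (simp add: \<beta>'_def)
  qed
  \<comment> \<open>A shifted root meets \<alpha> i only for one of the finitely many values
    \<alpha> i - \<beta> j of \<open>t\<close>. All are avoided near 0; the value 0 itself is
    excluded because \<open>at 0\<close> is a punctured neighbourhood.\<close>
  have "eventually (\<lambda>t. \<forall>i\<in>{1..m}. \<forall>j\<in>{1..n}. t \<noteq> \<alpha> i - \<beta> j) (at 0)"
    by (intro eventually_ball_finite ballI eventually_neq_at_within) auto
  then have ev: "eventually (\<lambda>t. adj_mat (sylvester_mat a (b' t)) = lagrange_adj m n c \<alpha> d (\<beta>' t)) (at 0)"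
  proof (rule eventually_mono)
    fix t assume t: "\<forall>i\<in>{1..m}. \<forall>j\<in>{1..n}. t \<noteq> \<alpha> i - \<beta> j"
    have inj_t: "inj_on (\<beta>' t) {1..n}"
      using inj(2) unfolding inj_on_def \<beta>'_def add_right_cancel .
    have "poly (root_poly d {1..n} (\<beta>' t)) (\<alpha> i) \<noteq> 0" if i: "i \<in> {1..m}" for i
    proof -
      have "\<alpha> i - \<beta>' t j \<noteq> 0" if "j \<in> {1..n}" for j
      proof
        assume "\<alpha> i - \<beta>' t j = 0"
        then have "t = \<alpha> i - \<beta> j" by (simp add: \<beta>'_def)
        with t i that show False by blast
      qed
      then show ?thesis
        using cd by (simp add: poly_root_poly)
    qed
    then show "adj_mat (sylvester_mat a (b' t)) = lagrange_adj m n c \<alpha> d (\<beta>' t)"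
      unfolding a_def b'_def by (rule adj_mat_sylvester_mat_coprime[OF cd inj(1) inj_t])
  qed
  have "adj_mat (sylvester_mat a b) = lagrange_adj m n c \<alpha> d \<beta>"
  proof (rule eq_matI)
    fix i j
    assume "i < dim_row (lagrange_adj m n c \<alpha> d \<beta>)" "j < dim_col (lagrange_adj m n c \<alpha> d \<beta>)"
    then have ij: "i < ?N" "j < ?N" by (auto simp: lagrange_adj_def)
    have "((\<lambda>t. sylvester_mat a (b' t) $$ (i', j')) \<longlongrightarrow> sylvester_mat a b $$ (i', j')) (at 0)"
      if "i' < ?N" "j' < ?N" for i' j'
    proof -
      have "((\<lambda>t. coeff (b' t) l) \<longlongrightarrow> coeff b l) (at 0)" for l
        unfolding b'_def b_def by (intro tendsto_coeff_root_poly lim_\<beta>) auto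
      then show ?thesis
        using that a b b't by (auto simp: sylvester_index_mat)
    qed
    then have "((\<lambda>t. adj_mat (sylvester_mat a (b' t)) $$ (i, j)) \<longlongrightarrow>
        adj_mat (sylvester_mat a b) $$ (i, j)) (at 0)"
      by (intro tendsto_adj_mat[OF S' S _ ij])
    \<comment> \<open>By \<open>ev\<close> the formula eventually coincides with the adjugate and so
      inherits its limit; uniqueness of limits then identifies the two values at
      \<open>t = 0\<close>.\<close>
    then have lim1: "((\<lambda>t. lagrange_adj m n c \<alpha> d (\<beta>' t) $$ (i, j)) \<longlongrightarrow>
        adj_mat (sylvester_mat a b) $$ (i, j)) (at 0)"
      by (rule Lim_transform_eventually) (use ev in \<open>auto elim: eventually_mono\<close>)
    have "((\<lambda>t. adj_half ?N n m (b' t) c {1..m} \<alpha> i j) \<longlongrightarrow> adj_half ?N n m b c {1..m} \<alpha> i j) (at 0)"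
      using inj cd unfolding b'_def b_def
      by (intro tendsto_adj_half tendsto_poly_root_poly lim_\<beta> tendsto_const) auto
    moreover have "((\<lambda>t. adj_half ?N 0 n a d {1..n} (\<beta>' t) i j) \<longlongrightarrow> adj_half ?N 0 n a d {1..n} \<beta> i j) (at 0)"
      using inj cd by (intro tendsto_adj_half tendsto_poly lim_\<beta>) auto
    ultimately have "((\<lambda>t. lagrange_adj m n c \<alpha> d (\<beta>' t) $$ (i, j)) \<longlongrightarrow>
        lagrange_adj m n c \<alpha> d \<beta> $$ (i, j)) (at 0)"
      using ij unfolding lagrange_adj_def b'_def b_def a_def
      by (auto intro!: tendsto_add tendsto_mult tendsto_const)
    with lim1 show "adj_mat (sylvester_mat a b) $$ (i, j) = lagrange_adj m n c \<alpha> d \<beta> $$ (i, j)"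
      by (intro tendsto_unique[OF _ lim1]) auto
  qed (use adj_mat(1)[OF S] in \<open>auto simp: lagrange_adj_def\<close>)
  then show ?thesis by (simp add: a_def b_def)
qed

section \<open>The formula as a sum of columns times rows\<close>

lemma index_Lambda_col_mult_row:
  assumes "i < N" "j < dim_vec v"
  shows "(s \<cdot>\<^sub>m (Lambda_col N x * mat_of_row v)) $$ (i, j) = s * x ^ (N - 1 - i) * v $ j"
  using assms by (simp add: Lambda_col_def scalar_prod_def mult_ac)

theorem theorem1:
  fixes m n :: nat
    and ac bc :: "nat \<Rightarrow> complex"
    and a b :: "complex poly"
    and \<alpha> \<beta> :: "nat \<Rightarrow> complex"
  assumes "m \<ge> 1" and "n \<ge> 1"
    and "a = (\<Sum>k=0..m. monom (ac k) (m - k))"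
    and "a = smult (ac 0) (\<Prod>i=1..m. [:- \<alpha> i, 1:])"
    and "b = (\<Sum>k=0..n. monom (bc k) (n - k))"
    and "b = smult (bc 0) (\<Prod>j=1..n. [:- \<beta> j, 1:])"
    and "ac 0 * bc 0 \<noteq> 0"
    and "inj_on \<alpha> {1..m}" and "inj_on \<beta> {1..n}"
  shows "adj_mat (sylvester_mat a b) =
    ac 0 ^ n \<cdot>\<^sub>m sum_of_mats (m + n) (m + n)
      (\<lambda>i. ((\<Prod>r\<in>{1..m} - {i}. poly b (\<alpha> r)) / poly (a div [:- \<alpha> i, 1:]) (\<alpha> i)) \<cdot>\<^sub>m
        (Lambda_col (m + n) (\<alpha> i) *
          mat_of_row (0\<^sub>v n @\<^sub>v row_poly m (a div [:- \<alpha> i, 1:]))))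
      {1..m}
    + ((-1) ^ (m * n) * bc 0 ^ m) \<cdot>\<^sub>m sum_of_mats (m + n) (m + n)
      (\<lambda>j. ((\<Prod>s\<in>{1..n} - {j}. poly a (\<beta> s)) / poly (b div [:- \<beta> j, 1:]) (\<beta> j)) \<cdot>\<^sub>m
        (Lambda_col (m + n) (\<beta> j) *
          mat_of_row (row_poly n (b div [:- \<beta> j, 1:]) @\<^sub>v 0\<^sub>v m)))
      {1..n}"
    (is "_ = _ \<cdot>\<^sub>m sum_of_mats _ _ ?A _ + _ \<cdot>\<^sub>m sum_of_mats _ _ ?B _")
proof -
  let ?N = "m + n"
  have a: "a = root_poly (ac 0) {1..m} \<alpha>" and b: "b = root_poly (bc 0) {1..n} \<beta>"
    by (subst assms, simp add: root_poly_def)+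
  have cd: "ac 0 \<noteq> 0" "bc 0 \<noteq> 0" using assms(7) by auto
  have adiv: "a div [:- \<alpha> r, 1:] = root_poly (ac 0) ({1..m} - {r}) \<alpha>" if "r \<in> {1..m}" for r
    unfolding a using that by (intro root_poly_div) auto
  have bdiv: "b div [:- \<beta> r, 1:] = root_poly (bc 0) ({1..n} - {r}) \<beta>" if "r \<in> {1..n}" for r
    unfolding b using that by (intro root_poly_div) auto
  have carr: "?A r \<in> carrier_mat ?N ?N" "?B r \<in> carrier_mat ?N ?N" for r
    by (auto simp: Lambda_col_def row_poly_def)
  note idx = index_sum_of_mats[of "{1..m}" ?A ?N ?N, OF _ carr(1)]
    index_sum_of_mats[of "{1..n}" ?B ?N ?N, OF _ carr(2)]
  have "adj_mat (sylvester_mat a b) = lagrange_adj m n (ac 0) \<alpha> (bc 0) \<beta>"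
    unfolding a b by (rule adj_mat_sylvester_mat_root_poly[OF cd assms(8,9)])
  also have "\<dots> = ac 0 ^ n \<cdot>\<^sub>m sum_of_mats ?N ?N ?A {1..m}
      + ((-1) ^ (m * n) * bc 0 ^ m) \<cdot>\<^sub>m sum_of_mats ?N ?N ?B {1..n}" (is "_ = ?R")
  proof (rule eq_matI)
    show dims: "dim_row (lagrange_adj m n (ac 0) \<alpha> (bc 0) \<beta>) = dim_row ?R"
      "dim_col (lagrange_adj m n (ac 0) \<alpha> (bc 0) \<beta>) = dim_col ?R"
      using idx(1,3) by (auto simp: lagrange_adj_def)
    fix i j assume "i < dim_row ?R" "j < dim_col ?R"
    then have ij: "i < ?N" "j < ?N" using idx(1,3) by auto
    \<comment> \<open>The \<open>n\<close> leading zeros of the row vector become the offset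
      \<open>n\<close> in \<open>adj_half\<close>; in the second sum the zeros trail and the offset
      is 0.\<close>
    have A: "sum_of_mats ?N ?N ?A {1..m} $$ (i, j) = adj_half ?N n m b (ac 0) {1..m} \<alpha> i j"
      unfolding adj_half_def idx(2)[OF finite_atLeastAtMost ij]
    proof (rule sum.cong[OF refl])
      fix r assume r: "r \<in> {1..m}"
      show "?A r $$ (i, j) = (\<Prod>s\<in>{1..m} - {r}. poly b (\<alpha> s)) /
          poly (root_poly (ac 0) ({1..m} - {r}) \<alpha>) (\<alpha> r) * \<alpha> r ^ (?N - 1 - i) *
          (if n \<le> j \<and> j < n + m then coeff (root_poly (ac 0) ({1..m} - {r}) \<alpha>) (m - 1 - (j - n)) else 0)"
        using ij unfolding adiv[OF r] by (subst index_Lambda_col_mult_row) (auto simp: row_poly_def)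
    qed
    have B: "sum_of_mats ?N ?N ?B {1..n} $$ (i, j) = adj_half ?N 0 n a (bc 0) {1..n} \<beta> i j"
      unfolding adj_half_def idx(4)[OF finite_atLeastAtMost ij]
    proof (rule sum.cong[OF refl])
      fix r assume r: "r \<in> {1..n}"
      show "?B r $$ (i, j) = (\<Prod>s\<in>{1..n} - {r}. poly a (\<beta> s)) /
          poly (root_poly (bc 0) ({1..n} - {r}) \<beta>) (\<beta> r) * \<beta> r ^ (?N - 1 - i) *
          (if 0 \<le> j \<and> j < 0 + n then coeff (root_poly (bc 0) ({1..n} - {r}) \<beta>) (n - 1 - (j - 0)) else 0)"
        using ij unfolding bdiv[OF r] by (subst index_Lambda_col_mult_row) (auto simp: row_poly_def)
    qed
    have "?R $$ (i, j) = ac 0 ^ n * sum_of_mats ?N ?N ?A {1..m} $$ (i, j)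
        + (-1) ^ (m * n) * bc 0 ^ m * sum_of_mats ?N ?N ?B {1..n} $$ (i, j)"
      using ij idx(1,3) by auto
    also have "\<dots> = lagrange_adj m n (ac 0) \<alpha> (bc 0) \<beta> $$ (i, j)"
      unfolding A B using ij by (simp add: lagrange_adj_def a b)
    finally show "lagrange_adj m n (ac 0) \<alpha> (bc 0) \<beta> $$ (i, j) = ?R $$ (i, j)" ..
  qed
  finally show ?thesis .
qed

end
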